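(* Let $\mathcal{M}=\{\mathbf{M}^{(\lambda)}:\lambda>0\}$ and $\mathcal{N}=\{\mathbf{N}^{(\lambda)}:\lambda>0\}$ be arbitrary weight matrices (of sequences indexed by $\mathbb{N}_0^d$) and consider the following assertions: (i) $\mathcal{M}\{\preceq\}\mathcal{N}$; (ii) $\mathcal{S}_{\{\mathcal{M}\}}(\mathbb{R}^d)\subseteq\mathcal{S}_{\{\mathcal{N}\}}(\mathbb{R}^d)$ is valid with continuous inclusion. Then (i)$\Rightarrow$(ii) is valid for all dimensions $d\in\mathbb{N}$, and the classes in (ii) can be defined by joint or separated growth at infinity. If $\mathcal{M}$ is standard log-convex and Roumieu non-quasianalytic and if (ii) holds for the case $d=1$, then (ii)$\Rightarrow$(i) is valid, too.
   Context: $\mathbb{N}_0=\mathbb{N}\cup\{0\}$. A weight matrix is a family $\mathcal{M}=(\mathbf{M}^{(\lambda)})_{\lambda>0}$ of sequences $\mathbf{M}^{(\lambda)}=(M^{(\lambda)}_\alpha)_{\alpha\in\mathbb{N}_0^d}$ of positive reals with $M^{(\lambda)}_0=1$ and $M^{(\lambda)}_\alpha\le M^{(\kappa)}_\alpha$ for all $\alpha$ whenever $0<\lambda\le\kappa$. For $d=1$ it is standard log-convex if each $\mathbf{M}^{(\lambda)}\in\mathcal{LC}$, where $\mathcal{LC}$ is the set of positive sequences $(M_p)_{p\in\mathbb{N}_0}$ with $M_1\ge M_0=1$, $M_p^2\le M_{p-1}M_{p+1}$ for $p\ge 1$, and $\lim_{p\to\infty}(M_p)^{1/p}=\infty$. A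 sequence $\mathbf{M}\in\mathcal{LC}$ is non-quasianalytic if $\sum_{k\ge 1}M_{k-1}/M_k<\infty$; a standard log-convex matrix $\mathcal{M}$ is Roumieu non-quasianalytic if $\mathbf{M}^{(\lambda_0)}$ is non-quasianalytic for some $\lambda_0>0$. $\mathbf{M}\preceq\mathbf{N}$ means: there is $C\ge 1$ with $M_\alpha\le C^{|\alpha|}N_\alpha$ for all $\alpha$. $\mathcal{M}\{\preceq\}\mathcal{N}$ means: $\forall\lambda>0\ \exists\kappa>0:\ \mathbf{M}^{(\lambda)}\preceq\mathbf{N}^{(\kappa)}$. $\mathcal{S}_{\{\mathcal{M}\}}(\mathbb{R}^d)$ is the space of all $f\in C^\infty(\mathbb{R}^d)$ with $\sup_{\alpha,\beta\in\mathbb{N}_0^d}\frac{\|x^\alpha\partial^\beta f\|_\infty}{h^{|\alpha+\beta|}M^{(\lambda)}_{\alpha+\beta}}<\infty$ for some $\lambda,h>0$, with the inductive limit topology ($\|\cdot\|_\infty$ is the supremum norm on $\mathbb{R}^d$). This is the definition by joint growth at infinity; in the definition by separated growth at infinity, $M^{(\lambda)}_{\alpha+\beta}$ is replaced by $M^{(\lambda)}_\alpha M^{(\lambda)}_\beta$. *)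

theory Defs
  imports "HOL-Analysis.Analysis"
begin

section \<open>Weight sequences and weight matrices\<close>

text \<open>
  The index set of all multi-indices of length \<open>d\<close> is the type \<^typ>\<open>nat ^ 'd\<close>; its
  componentwise \<open>+\<close> and \<open>0\<close> are those of the library. A weight matrix is a function on the
  reals of which only the values at positive arguments matter.
\<close>

definition mlength :: "nat ^ 'd::finite \<Rightarrow> nat" where
  "mlength \<alpha> = (\<Sum>i\<in>UNIV. \<alpha> $ i)"

definition weight_matrix :: "(real \<Rightarrow> nat ^ 'd::finite \<Rightarrow> real) \<Rightarrow> bool" where
  "weight_matrix M \<longleftrightarrow>
     (\<forall>l>0. (\<forall>\<alpha>. M l \<alpha> > 0) \<and> M l 0 = 1) \<and>
     (\<forall>l k \<alpha>. 0 < l \<longrightarrow> l \<le> k \<longrightarrow> M l \<alpha> \<le> M k \<alpha>)"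

definition seq_le :: "(nat ^ 'd::finite \<Rightarrow> real) \<Rightarrow> (nat ^ 'd \<Rightarrow> real) \<Rightarrow> bool" where
  "seq_le A B \<longleftrightarrow> (\<exists>C\<ge>1. \<forall>\<alpha>. A \<alpha> \<le> C ^ mlength \<alpha> * B \<alpha>)"

definition roumieu_le ::
    "(real \<Rightarrow> nat ^ 'd::finite \<Rightarrow> real) \<Rightarrow> (real \<Rightarrow> nat ^ 'd \<Rightarrow> real) \<Rightarrow> bool" where
  "roumieu_le M N \<longleftrightarrow> (\<forall>l>0. \<exists>k>0. seq_le (M l) (N k))"

definition LC :: "(nat \<Rightarrow> real) set" where
  "LC = {A. (\<forall>p. A p > 0) \<and> A 0 = 1 \<and> A 1 \<ge> A 0 \<and>
            (\<forall>p\<ge>1. (A p)\<^sup>2 \<le> A (p - 1) * A (p + 1)) \<and>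
            filterlim (\<lambda>p. A p powr (1 / real p)) at_top sequentially}"

definition non_quasianalytic :: "(nat \<Rightarrow> real) \<Rightarrow> bool" where
  "non_quasianalytic A \<longleftrightarrow> summable (\<lambda>k. A k / A (Suc k))"

text \<open>
  The next two notions concern matrices of sequences indexed by \<open>nat\<close>. A matrix \<open>M\<close> indexed
  by \<^typ>\<open>nat ^ 'd\<close> with \<open>CARD('d) = 1\<close> corresponds to \<open>\<lambda>l p. M l (vec p)\<close>.
\<close>

definition standard_log_convex :: "(real \<Rightarrow> nat \<Rightarrow> real) \<Rightarrow> bool" where
  "standard_log_convex M \<longleftrightarrow> (\<forall>l>0. M l \<in> LC)"

definition roumieu_non_quasianalytic :: "(real \<Rightarrow> nat \<Rightarrow> real) \<Rightarrow> bool" where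
  "roumieu_non_quasianalytic M \<longleftrightarrow> (\<exists>l>0. non_quasianalytic (M l))"

section \<open>Partial derivatives and smooth functions\<close>

definition partial_deriv ::
    "'d::finite \<Rightarrow> (real ^ 'd \<Rightarrow> complex) \<Rightarrow> real ^ 'd \<Rightarrow> complex" where
  "partial_deriv i f x = vector_derivative (\<lambda>t. f (x + t *\<^sub>R axis i 1)) (at 0)"

text \<open>All iterated partial derivatives, in any order, exist everywhere and are continuous.\<close>

definition smooth :: "(real ^ 'd::finite \<Rightarrow> complex) \<Rightarrow> bool" where
  "smooth f \<longleftrightarrow>
     (\<forall>is. continuous_on UNIV (fold partial_deriv is f) \<and>
           (\<forall>i x. (\<lambda>t::real. fold partial_deriv is f (x + t *\<^sub>R axis i 1)) differentiable at 0))"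

text \<open>
  The derivatives of a multi-index are taken along an arbitrary fixed enumeration of the
  coordinates. For smooth functions, partial derivatives commute, so the choice is immaterial.
\<close>

definition multi_deriv ::
    "nat ^ 'd::finite \<Rightarrow> (real ^ 'd \<Rightarrow> complex) \<Rightarrow> real ^ 'd \<Rightarrow> complex" where
  "multi_deriv \<beta> f =
     fold (\<lambda>i. partial_deriv i ^^ (\<beta> $ i)) (SOME is. distinct is \<and> set is = UNIV) f"

definition monomial :: "nat ^ 'd::finite \<Rightarrow> real ^ 'd \<Rightarrow> real" where
  "monomial \<alpha> x = (\<Prod>i\<in>UNIV. (x $ i) ^ (\<alpha> $ i))"

section \<open>Gelfand--Shilov spaces of Roumieu type\<close>

datatype growth = Joint | Separated

fun growth_weight ::
    "growth \<Rightarrow> (nat ^ 'd::finite \<Rightarrow> real) \<Rightarrow> nat ^ 'd \<Rightarrow> nat ^ 'd \<Rightarrow> real" where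
  "growth_weight Joint A \<alpha> \<beta> = A (\<alpha> + \<beta>)"
| "growth_weight Separated A \<alpha> \<beta> = A \<alpha> * A \<beta>"

text \<open>The norm takes the value \<open>\<infinity>\<close> if the supremum is not finite.\<close>

definition gs_norm ::
    "growth \<Rightarrow> (nat ^ 'd::finite \<Rightarrow> real) \<Rightarrow> real \<Rightarrow> (real ^ 'd \<Rightarrow> complex) \<Rightarrow> ennreal" where
  "gs_norm g A h f =
     (SUP \<alpha>. SUP \<beta>.
        (SUP x. ennreal (norm (monomial \<alpha> x *\<^sub>R multi_deriv \<beta> f x))) /
        ennreal (h ^ mlength (\<alpha> + \<beta>) * growth_weight g A \<alpha> \<beta>))"

definition gs_step ::
    "growth \<Rightarrow> (nat ^ 'd::finite \<Rightarrow> real) \<Rightarrow> real \<Rightarrow> (real ^ 'd \<Rightarrow> complex) set" where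
  "gs_step g A h = {f. smooth f \<and> gs_norm g A h f < \<infinity>}"

definition gs_space ::
    "growth \<Rightarrow> (real \<Rightarrow> nat ^ 'd::finite \<Rightarrow> real) \<Rightarrow> (real ^ 'd \<Rightarrow> complex) set" where
  "gs_space g M = (\<Union>l\<in>{0<..}. \<Union>h\<in>{0<..}. gs_step g (M l) h)"

definition absolutely_convex :: "('a \<Rightarrow> complex) set \<Rightarrow> bool" where
  "absolutely_convex V \<longleftrightarrow>
     (\<forall>u\<in>V. \<forall>v\<in>V. \<forall>a b. norm a + norm b \<le> 1 \<longrightarrow> (\<lambda>x. a * u x + b * v x) \<in> V)"

text \<open>
  The locally convex inductive limit of the normed steps: the absolutely convex sets that contain
  a ball around \<open>0\<close> of every step form a basis of neighbourhoods of \<open>0\<close>.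
\<close>

definition gs_zero_nbhd ::
    "growth \<Rightarrow> (real \<Rightarrow> nat ^ 'd::finite \<Rightarrow> real) \<Rightarrow> (real ^ 'd \<Rightarrow> complex) set \<Rightarrow> bool" where
  "gs_zero_nbhd g M V \<longleftrightarrow> V \<subseteq> gs_space g M \<and> absolutely_convex V \<and>
     (\<forall>l>0. \<forall>h>0. \<exists>\<epsilon>>0. \<forall>f\<in>gs_step g (M l) h. gs_norm g (M l) h f < ennreal \<epsilon> \<longrightarrow> f \<in> V)"

definition gs_open ::
    "growth \<Rightarrow> (real \<Rightarrow> nat ^ 'd::finite \<Rightarrow> real) \<Rightarrow> (real ^ 'd \<Rightarrow> complex) set \<Rightarrow> bool" where
  "gs_open g M U \<longleftrightarrow> U \<subseteq> gs_space g M \<and>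
     (\<forall>f\<in>U. \<exists>V. gs_zero_nbhd g M V \<and> (\<forall>v\<in>V. (\<lambda>x. f x + v x) \<in> U))"

definition gs_topology ::
    "growth \<Rightarrow> (real \<Rightarrow> nat ^ 'd::finite \<Rightarrow> real) \<Rightarrow> (real ^ 'd \<Rightarrow> complex) topology" where
  "gs_topology g M = topology (gs_open g M)"

lemma gs_zero_nbhd_Int:
  assumes "gs_zero_nbhd g M V" "gs_zero_nbhd g M W"
  shows "gs_zero_nbhd g M (V \<inter> W)"
  unfolding gs_zero_nbhd_def
proof (intro conjI allI impI)
  show "V \<inter> W \<subseteq> gs_space g M" "absolutely_convex (V \<inter> W)"
    using assms by (auto simp: gs_zero_nbhd_def absolutely_convex_def)
next
  fix l h :: real assume lh: "l > 0" "h > 0"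
  obtain d where d: "d > 0" "\<forall>f\<in>gs_step g (M l) h. gs_norm g (M l) h f < ennreal d \<longrightarrow> f \<in> V"
    using assms(1) lh unfolding gs_zero_nbhd_def by meson
  obtain e where e: "e > 0" "\<forall>f\<in>gs_step g (M l) h. gs_norm g (M l) h f < ennreal e \<longrightarrow> f \<in> W"
    using assms(2) lh unfolding gs_zero_nbhd_def by meson
  have "f \<in> V \<inter> W"
    if f: "f \<in> gs_step g (M l) h" "gs_norm g (M l) h f < ennreal (min d e)" for f
  proof -
    have "gs_norm g (M l) h f < ennreal d" "gs_norm g (M l) h f < ennreal e"
      using f(2) by (rule less_le_trans; simp add: ennreal_leI)+
    with d e f(1) show ?thesis by blast
  qed
  with d e show "\<exists>\<epsilon>>0. \<forall>f\<in>gs_step g (M l) h. gs_norm g (M l) h f < ennreal \<epsilon> \<longrightarrow> f \<in> V \<inter> W"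
    by (intro exI[of _ "min d e"]) simp
qed

lemma istopology_gs_open: "istopology (gs_open g M)"
  unfolding istopology_def
proof (intro conjI allI impI)
  fix S T assume S: "gs_open g M S" and T: "gs_open g M T"
  show "gs_open g M (S \<inter> T)"
    unfolding gs_open_def
  proof (intro conjI ballI)
    show "S \<inter> T \<subseteq> gs_space g M" using S by (auto simp: gs_open_def)
    fix f assume f: "f \<in> S \<inter> T"
    obtain V where V: "gs_zero_nbhd g M V" "\<forall>v\<in>V. (\<lambda>x. f x + v x) \<in> S"
      using S f unfolding gs_open_def by blast
    obtain W where W: "gs_zero_nbhd g M W" "\<forall>v\<in>W. (\<lambda>x. f x + v x) \<in> T"
      using T f unfolding gs_open_def by blast
    show "\<exists>V. gs_zero_nbhd g M V \<and> (\<forall>v\<in>V. (\<lambda>x. f x + v x) \<in> S \<inter> T)"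
      using V W gs_zero_nbhd_Int by (intro exI[of _ "V \<inter> W"]) auto
  qed
next
  fix K assume K: "\<forall>S\<in>K. gs_open g M S"
  show "gs_open g M (\<Union>K)"
    unfolding gs_open_def
  proof (intro conjI ballI)
    show "\<Union>K \<subseteq> gs_space g M" using K by (auto simp: gs_open_def)
    fix f assume "f \<in> \<Union>K"
    then obtain S where S: "S \<in> K" "f \<in> S" by blast
    then obtain V where "gs_zero_nbhd g M V" "\<forall>v\<in>V. (\<lambda>x. f x + v x) \<in> S"
      using K unfolding gs_open_def by blast
    then show "\<exists>V. gs_zero_nbhd g M V \<and> (\<forall>v\<in>V. (\<lambda>x. f x + v x) \<in> \<Union>K)"
      using S by blast
  qed
qed

lemma openin_gs_topology: "openin (gs_topology g M) = gs_open g M"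
  unfolding gs_topology_def by (rule topology_inverse'[OF istopology_gs_open])

definition gs_continuously_included ::
    "growth \<Rightarrow> (real \<Rightarrow> nat ^ 'd::finite \<Rightarrow> real) \<Rightarrow> (real \<Rightarrow> nat ^ 'd \<Rightarrow> real) \<Rightarrow> bool" where
  "gs_continuously_included g M N \<longleftrightarrow>
     gs_space g M \<subseteq> gs_space g N \<and>
     continuous_map (gs_topology g M) (gs_topology g N) (\<lambda>f. f)"

end

theory Submission
  imports Defs "HOL-Complex_Analysis.Cauchy_Integral_Formula"
begin

text \<open>
  If \<open>M\<^sub>l(\<alpha>) \<le> C\<^bsup>|\<alpha>|\<^esup> N\<^sub>k(\<alpha>)\<close>, then the norm with parameters \<open>(N\<^sub>k, C h)\<close> is at most the norm with
  parameters \<open>(M\<^sub>l, h)\<close>, for either kind of growth. Hence every step of the space of \<open>M\<close> embeds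
  continuously into a step of the space of \<open>N\<close>, and so does the inductive limit: the trace of a
  neighbourhood of zero is a neighbourhood of zero
  (\<open>roumieu_le_imp_gs_continuously_included\<close>).

  For the converse in dimension one, fix an index \<open>l\<close>, which may be enlarged beyond the index of a
  non-quasianalytic sequence, and put \<open>A = M\<^sub>l\<close>. It suffices to find one function \<open>f\<close> in the space
  of \<open>M\<close> such that \<open>|f\<^bsup>(p)\<^esup>(0)| \<ge> A\<^sub>p\<close> for all \<open>p \<ge> 1\<close>, because membership in the space of \<open>N\<close>
  bounds the same derivatives by \<open>C h\<^sup>p N\<^sub>k(p)\<close> for some \<open>k\<close>. Such a function is
  \<open>f(x) = \<Sum>\<^sub>k c\<^sub>k exp(i \<tau>\<^sub>k x) exp(-x\<^sup>2)\<close> with \<open>\<tau>\<^sub>k = 2 A\<^bsub>k+1\<^esub> / A\<^sub>k\<close> and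
  \<open>c\<^sub>k = A\<^bsub>k+1\<^esub> / \<tau>\<^sub>k\<^bsup>k+1\<^esup>\<close>.
  Three facts make it work (\<open>exists_large_derivatives_at_zero\<close>).

  First, log-convexity says that \<open>log (\<tau>\<^sub>k/2)\<close> is the slope of a supporting line of \<open>log A\<close>, whence
  \<open>c\<^sub>k \<tau>\<^sub>k\<^sup>j \<le> 2\<^sup>j A\<^sub>j 2\<^bsup>-k-1\<^esup>\<close> (\<open>LC_tangent\<close>). So the trigonometric series without the
  Gaussian can be differentiated termwise, and its \<open>j\<close>-th derivative is at most \<open>2\<^sup>j A\<^sub>j\<close>.

  Second, non-quasianalyticity forces \<open>p! \<le> S\<^sup>p A\<^sub>p\<close> (\<open>fact_le_non_quasianalytic\<close>), so the Gaussian,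
  which satisfies \<open>|x\<^sup>a g\<^bsup>(b)\<^esup>(x)| \<le> K a! b!\<close> by Cauchy's inequality, can serve as the factor that
  provides the decay. The product rule and \<open>A\<^sub>j A\<^bsub>b-j\<^esub> \<le> A\<^sub>b\<close> then bound \<open>|x\<^sup>a f\<^bsup>(b)\<^esup>(x)|\<close>
  by \<open>K (2+S)\<^bsup>a+b\<^esup> A\<^sub>a A\<^sub>b\<close>, which is what separated growth demands, and joint growth demands
  less.

  Third, nothing cancels at the origin. The Gaussian is positive definite, so its \<open>n\<close>-th derivative
  at \<open>0\<close> is \<open>i\<^sup>n\<close> times a nonnegative number, and the same holds for \<open>exp(i \<tau> x)\<close>. Hence
  \<open>f\<^bsup>(p)\<^esup>(0)\<close> is \<open>i\<^sup>p\<close> times a sum of nonnegative terms, one of which is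
  \<open>c\<^sub>k \<tau>\<^sub>k\<^sup>p = A\<^sub>p\<close> with \<open>k = p - 1\<close>.
\<close>

section \<open>Norms and linear structure of the spaces\<close>

lemma mlength_add: "mlength (\<alpha> + \<beta>) = mlength \<alpha> + mlength \<beta>"
  by (simp add: mlength_def sum.distrib)

lemma growth_weight_pos:
  assumes "\<And>\<alpha>. A \<alpha> > 0"
  shows "growth_weight g A \<alpha> \<beta> > 0"
  using assms by (cases g) auto

lemma gs_norm_le_iff:
  assumes "\<And>\<alpha>. A \<alpha> > 0" "h > 0" "C \<ge> 0"
  shows "gs_norm g A h f \<le> ennreal C \<longleftrightarrow>
    (\<forall>\<alpha> \<beta> x. norm (monomial \<alpha> x *\<^sub>R multi_deriv \<beta> f x)
               \<le> C * (h ^ mlength (\<alpha> + \<beta>) * growth_weight g A \<alpha> \<beta>))"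
proof -
  have "(SUP x. ennreal (norm (monomial \<alpha> x *\<^sub>R multi_deriv \<beta> f x))) /
          ennreal (h ^ mlength (\<alpha> + \<beta>) * growth_weight g A \<alpha> \<beta>) \<le> ennreal C
        \<longleftrightarrow> (\<forall>x. norm (monomial \<alpha> x *\<^sub>R multi_deriv \<beta> f x)
               \<le> C * (h ^ mlength (\<alpha> + \<beta>) * growth_weight g A \<alpha> \<beta>))"
    (is "?S / ennreal ?w \<le> _ \<longleftrightarrow> _") for \<alpha> \<beta>
  proof -
    have w: "?w > 0" using growth_weight_pos[of A g] assms by simp
    then have "s / ennreal ?w \<le> ennreal C \<longleftrightarrow> s \<le> ennreal (C * ?w)" for s
      using assms(3)
      by (cases s) (auto simp: divide_ennreal ennreal_top_divide ennreal_le_iff pos_divide_le_eq top_unique)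
    then have "?S / ennreal ?w \<le> ennreal C \<longleftrightarrow> ?S \<le> ennreal (C * ?w)" .
    also have "\<dots> \<longleftrightarrow> (\<forall>x. norm (monomial \<alpha> x *\<^sub>R multi_deriv \<beta> f x) \<le> C * ?w)"
      using w assms(3) by (simp add: SUP_le_iff ennreal_le_iff del: norm_scaleR)
    finally show ?thesis .
  qed
  then show ?thesis
    unfolding gs_norm_def by (simp add: SUP_le_iff del: norm_scaleR)
qed

lemma gs_step_iff:
  assumes "\<And>\<alpha>. A \<alpha> > 0" "h > 0"
  shows "f \<in> gs_step g A h \<longleftrightarrow> smooth f \<and> (\<exists>C\<ge>0. \<forall>\<alpha> \<beta> x.
    norm (monomial \<alpha> x *\<^sub>R multi_deriv \<beta> f x)
      \<le> C * (h ^ mlength (\<alpha> + \<beta>) * growth_weight g A \<alpha> \<beta>))"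
proof -
  have "gs_norm g A h f < \<infinity> \<longleftrightarrow> (\<exists>C\<ge>0. gs_norm g A h f \<le> ennreal C)"
    by (cases "gs_norm g A h f") (auto simp: top_unique)
  then show ?thesis
    unfolding gs_step_def mem_Collect_eq using gs_norm_le_iff[of A h _ g f, OF assms] by meson
qed

lemma fold_funpow_eq_fold_concat:
  "fold (\<lambda>i. F i ^^ n i) is f = fold F (concat (map (\<lambda>i. replicate (n i) i) is)) f"
  by (induction "is" arbitrary: f) simp_all

text \<open>
  Smoothness speaks about iterated partial derivatives along lists of directions; this brings the
  derivatives that occur in the norms into that form.
\<close>

lemma multi_deriv_eq_fold: "\<exists>is. \<forall>f. multi_deriv \<beta> f = fold partial_deriv is f"
  unfolding multi_deriv_def fold_funpow_eq_fold_concat by blast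

lemma fold_partial_deriv_linear:
  assumes u: "smooth u" and v: "smooth v"
  shows "fold partial_deriv is (\<lambda>x. a * u x + b * v x) =
         (\<lambda>x. a * fold partial_deriv is u x + b * fold partial_deriv is v x)"
proof (induction "is" rule: rev_induct)
  case (snoc i "is")
  have "((\<lambda>t. fold partial_deriv is f (x + t *\<^sub>R axis i 1)) has_vector_derivative
          partial_deriv i (fold partial_deriv is f) x) (at 0)" if "smooth f" for f x
    using that unfolding smooth_def partial_deriv_def by (simp add: vector_derivative_works)
  then have "((\<lambda>t. a * fold partial_deriv is u (x + t *\<^sub>R axis i 1)
                 + b * fold partial_deriv is v (x + t *\<^sub>R axis i 1)) has_vector_derivative
          (a * partial_deriv i (fold partial_deriv is u) x
           + b * partial_deriv i (fold partial_deriv is v) x)) (at 0)" for x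
    using u v by (intro has_vector_derivative_add has_vector_derivative_mult_right) auto
  from this[THEN vector_derivative_at] show ?case
    by (simp add: snoc.IH partial_deriv_def[of i "\<lambda>x. _ x + _ x"])
qed simp

lemma smooth_linear:
  assumes u: "smooth u" and v: "smooth v"
  shows "smooth (\<lambda>x. a * u x + b * v x)"
  unfolding smooth_def fold_partial_deriv_linear[OF assms]
proof (intro allI conjI)
  fix "is" :: "'a list" and i :: 'a and x :: "real ^ 'a"
  show "continuous_on UNIV (\<lambda>x. a * fold partial_deriv is u x + b * fold partial_deriv is v x)"
    using u v unfolding smooth_def by (intro continuous_intros) auto
  show "(\<lambda>t. a * fold partial_deriv is u (x + t *\<^sub>R axis i 1)
           + b * fold partial_deriv is v (x + t *\<^sub>R axis i 1)) differentiable at 0"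
    using u v unfolding smooth_def by (intro differentiable_add differentiable_mult) auto
qed

lemma gs_step_linear:
  assumes A: "\<And>\<alpha>. A \<alpha> > 0" "h > 0" and u: "u \<in> gs_step g A h" and v: "v \<in> gs_step g A h"
  shows "(\<lambda>x. a * u x + b * v x) \<in> gs_step g A h"
proof -
  let ?w = "\<lambda>\<alpha> \<beta>. h ^ mlength (\<alpha> + \<beta>) * growth_weight g A \<alpha> \<beta>"
  obtain C D where C: "C \<ge> 0"
      "\<And>\<alpha> \<beta> x. norm (monomial \<alpha> x *\<^sub>R multi_deriv \<beta> u x) \<le> C * ?w \<alpha> \<beta>"
    and D: "D \<ge> 0" "\<And>\<alpha> \<beta> x. norm (monomial \<alpha> x *\<^sub>R multi_deriv \<beta> v x) \<le> D * ?w \<alpha> \<beta>"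
    and sm: "smooth u" "smooth v"
    using u v unfolding gs_step_iff[of A h, OF A] by blast
  have "norm (monomial \<alpha> x *\<^sub>R multi_deriv \<beta> (\<lambda>x. a * u x + b * v x) x)
      \<le> (norm a * C + norm b * D) * ?w \<alpha> \<beta>" for \<alpha> \<beta> x
  proof -
    obtain "is" where "is": "\<And>f. multi_deriv \<beta> f = fold partial_deriv is f"
      using multi_deriv_eq_fold[of \<beta>] by blast
    have "monomial \<alpha> x *\<^sub>R multi_deriv \<beta> (\<lambda>x. a * u x + b * v x) x
        = a * (monomial \<alpha> x *\<^sub>R multi_deriv \<beta> u x) + b * (monomial \<alpha> x *\<^sub>R multi_deriv \<beta> v x)"
      unfolding "is" fold_partial_deriv_linear[OF sm] by (simp add: scaleR_add_right)
    also have "norm \<dots> \<le> norm a * (C * ?w \<alpha> \<beta>) + norm b * (D * ?w \<alpha> \<beta>)"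
      by (intro norm_triangle_mono order_trans[OF norm_mult_ineq] mult_left_mono C D) auto
    finally show ?thesis by (simp add: algebra_simps)
  qed
  moreover have "norm a * C + norm b * D \<ge> 0" using C D by simp
  ultimately show ?thesis
    unfolding gs_step_iff[of A h, OF A] using smooth_linear[OF sm] by blast
qed

text \<open>
  The pointwise hypothesis on \<open>h\<^bsup>|\<alpha>|\<^esup> A(\<alpha>)\<close> covers both kinds of growth because
  \<open>|\<alpha> + \<beta>| = |\<alpha>| + |\<beta>|\<close>: for separated growth the inequalities at \<open>\<alpha>\<close> and \<open>\<beta>\<close> are multiplied.
\<close>

lemma gs_norm_mono:
  assumes A: "\<And>\<alpha>. A \<alpha> > 0" and B: "\<And>\<alpha>. B \<alpha> > 0" and h: "h > 0" "k > 0"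
    and le: "\<And>\<alpha>. h ^ mlength \<alpha> * A \<alpha> \<le> k ^ mlength \<alpha> * B \<alpha>"
  shows "gs_norm g B k f \<le> gs_norm g A h f"
proof -
  have w: "h ^ mlength (\<alpha> + \<beta>) * growth_weight g A \<alpha> \<beta>
         \<le> k ^ mlength (\<alpha> + \<beta>) * growth_weight g B \<alpha> \<beta>" for \<alpha> \<beta>
  proof (cases g)
    case Joint then show ?thesis using le by simp
  next
    case Separated
    have "(h ^ mlength \<alpha> * A \<alpha>) * (h ^ mlength \<beta> * A \<beta>)
        \<le> (k ^ mlength \<alpha> * B \<alpha>) * (k ^ mlength \<beta> * B \<beta>)"
      using A B h by (intro mult_mono le mult_nonneg_nonneg) (auto simp: less_imp_le)
    then show ?thesis using Separated by (simp add: mlength_add power_add ac_simps)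
  qed
  show ?thesis
  proof (cases "gs_norm g A h f")
    case (real C)
    then have "norm (monomial \<alpha> x *\<^sub>R multi_deriv \<beta> f x)
               \<le> C * (h ^ mlength (\<alpha> + \<beta>) * growth_weight g A \<alpha> \<beta>)" for \<alpha> \<beta> x
      using gs_norm_le_iff[of A h C, OF A h(1)] by (metis order_refl)
    then have "norm (monomial \<alpha> x *\<^sub>R multi_deriv \<beta> f x)
               \<le> C * (k ^ mlength (\<alpha> + \<beta>) * growth_weight g B \<alpha> \<beta>)" for \<alpha> \<beta> x
      using w real(1) by (meson mult_left_mono order_trans)
    then show ?thesis
      unfolding real(2) gs_norm_le_iff[of B k C, OF B h(2) real(1)] by blast
  qed simp
qed

lemma gs_step_mono:
  assumes "\<And>\<alpha>. A \<alpha> > 0" "\<And>\<alpha>. B \<alpha> > 0" "h > 0" "k > 0"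
    and "\<And>\<alpha>. h ^ mlength \<alpha> * A \<alpha> \<le> k ^ mlength \<alpha> * B \<alpha>"
  shows "gs_step g A h \<subseteq> gs_step g B k"
  using gs_norm_mono[OF assms, of g] unfolding gs_step_def by (auto intro: le_less_trans)

text \<open>
  Two functions from different steps lie in a common step, because the sequences increase with the
  index and the norms decrease in \<open>h\<close>.
\<close>

lemma gs_space_linear:
  assumes M: "weight_matrix M" and u: "u \<in> gs_space g M" and v: "v \<in> gs_space g M"
  shows "(\<lambda>x. a * u x + b * v x) \<in> gs_space g M"
proof -
  obtain l h where l: "l > 0" "h > 0" "u \<in> gs_step g (M l) h"
    using u unfolding gs_space_def by auto
  obtain l' h' where l': "l' > 0" "h' > 0" "v \<in> gs_step g (M l') h'"
    using v unfolding gs_space_def by auto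
  let ?l = "max l l'" and ?h = "max h h'"
  have pos: "M k \<alpha> > 0" if "k > 0" for k \<alpha> using M that unfolding weight_matrix_def by blast
  have mono: "M k \<alpha> \<le> M k' \<alpha>" if "0 < k" "k \<le> k'" for k k' \<alpha>
    using M that unfolding weight_matrix_def by blast
  have "u \<in> gs_step g (M ?l) ?h"
    using l l' pos mono
    by (intro subsetD[OF gs_step_mono l(3)] mult_mono power_mono) (auto simp: less_imp_le)
  moreover have "v \<in> gs_step g (M ?l) ?h"
    using l l' pos mono
    by (intro subsetD[OF gs_step_mono l'(3)] mult_mono power_mono) (auto simp: less_imp_le)
  ultimately have "(\<lambda>x. a * u x + b * v x) \<in> gs_step g (M ?l) ?h"
    using l l' pos by (intro gs_step_linear) auto
  then show ?thesis unfolding gs_space_def using l l'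
    by (intro UN_I[of ?l] UN_I[of ?h]) auto
qed

lemma gs_zero_nbhd_gs_space:
  assumes "weight_matrix M"
  shows "gs_zero_nbhd g M (gs_space g M)"
proof -
  have "gs_step g (M l) h \<subseteq> gs_space g M" if "l > 0" "h > 0" for l h
    unfolding gs_space_def using that by auto
  then show ?thesis
    unfolding gs_zero_nbhd_def absolutely_convex_def using gs_space_linear[OF assms]
    by (auto intro: exI[of _ 1])
qed

lemma topspace_gs_topology:
  assumes "weight_matrix M"
  shows "topspace (gs_topology g M) = gs_space g M"
proof
  show "topspace (gs_topology g M) \<subseteq> gs_space g M"
    unfolding topspace_def openin_gs_topology gs_open_def by blast
  have "(\<lambda>x. f x + v x) \<in> gs_space g M" if "f \<in> gs_space g M" "v \<in> gs_space g M" for f v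
    using gs_space_linear[OF assms that, of 1 1] by simp
  then have "gs_open g M (gs_space g M)"
    unfolding gs_open_def using gs_zero_nbhd_gs_space[OF assms] by blast
  then show "gs_space g M \<subseteq> topspace (gs_topology g M)"
    unfolding topspace_def openin_gs_topology by blast
qed

section \<open>Continuous inclusion of the spaces\<close>

text \<open>
  A neighbourhood of zero \<open>V\<close> for \<open>N\<close> need not lie inside the space of \<open>M\<close>, so its trace on that
  space is used. The trace is absolutely convex since the space is linear, and it contains a ball of
  each step for \<open>M\<close> since that step maps into one for \<open>N\<close> with norm at most one.
\<close>

lemma roumieu_le_imp_gs_continuously_included:
  assumes M: "weight_matrix M" and N: "weight_matrix N" and le: "roumieu_le M N"
  shows "gs_continuously_included g M N"
proof -
  have posM: "M k \<alpha> > 0" and posN: "N k \<alpha> > 0" if "k > 0" for k \<alpha>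
    using M N that unfolding weight_matrix_def by blast+
  have step: "\<exists>k>0. \<exists>h'>0. gs_step g (M l) h \<subseteq> gs_step g (N k) h' \<and>
                (\<forall>f. gs_norm g (N k) h' f \<le> gs_norm g (M l) h f)" if lh: "l > 0" "h > 0" for l h
  proof -
    obtain k C where k: "k > 0" "C \<ge> 1" "\<And>\<alpha>. M l \<alpha> \<le> C ^ mlength \<alpha> * N k \<alpha>"
      using le lh unfolding roumieu_le_def seq_le_def by blast
    have *: "h ^ mlength \<alpha> * M l \<alpha> \<le> (h * C) ^ mlength \<alpha> * N k \<alpha>" for \<alpha>
      using mult_left_mono[OF k(3), of "h ^ mlength \<alpha>" \<alpha>] lh
      by (simp add: power_mult_distrib mult.assoc)
    show ?thesis
      using k lh gs_step_mono[of "M l" "N k" h "h * C"] gs_norm_mono[of "M l" "N k" h "h * C"]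
        posM posN * by (intro exI[of _ k] exI[of _ "h * C"] conjI) auto
  qed
  have sub: "gs_space g M \<subseteq> gs_space g N"
  proof
    fix f assume "f \<in> gs_space g M"
    then obtain l h where "l > 0" "h > 0" "f \<in> gs_step g (M l) h" unfolding gs_space_def by auto
    with step[of l h] show "f \<in> gs_space g N" unfolding gs_space_def by auto
  qed
  have nbhd: "gs_zero_nbhd g M (V \<inter> gs_space g M)" if V: "gs_zero_nbhd g N V" for V
    unfolding gs_zero_nbhd_def
  proof (intro conjI allI impI)
    show "absolutely_convex (V \<inter> gs_space g M)"
      using V gs_space_linear[OF M] unfolding gs_zero_nbhd_def absolutely_convex_def by blast
  next
    fix l h :: real assume lh: "l > 0" "h > 0"
    obtain k h' where k: "k > 0" "h' > 0" "gs_step g (M l) h \<subseteq> gs_step g (N k) h'"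
        "\<And>f. gs_norm g (N k) h' f \<le> gs_norm g (M l) h f"
      using step[OF lh] by blast
    obtain \<epsilon> where \<epsilon>: "\<epsilon> > 0" "\<forall>f\<in>gs_step g (N k) h'. gs_norm g (N k) h' f < ennreal \<epsilon> \<longrightarrow> f \<in> V"
      using V k(1,2) unfolding gs_zero_nbhd_def by meson
    have "gs_step g (M l) h \<subseteq> gs_space g M" unfolding gs_space_def using lh by auto
    with \<epsilon> k(3,4) show "\<exists>\<epsilon>>0. \<forall>f\<in>gs_step g (M l) h.
        gs_norm g (M l) h f < ennreal \<epsilon> \<longrightarrow> f \<in> V \<inter> gs_space g M"
      by (intro exI[of _ \<epsilon>]) (auto intro: le_less_trans)
  qed auto
  have "gs_open g M (U \<inter> gs_space g M)" if U: "gs_open g N U" for U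
    unfolding gs_open_def
  proof (intro conjI ballI)
    fix f assume f: "f \<in> U \<inter> gs_space g M"
    then obtain V where V: "gs_zero_nbhd g N V" "\<forall>v\<in>V. (\<lambda>x. f x + v x) \<in> U"
      using U unfolding gs_open_def by blast
    moreover have "(\<lambda>x. f x + v x) \<in> gs_space g M" if "v \<in> gs_space g M" for v
      using gs_space_linear[OF M _ that, of f 1 1] f by simp
    ultimately show "\<exists>V. gs_zero_nbhd g M V \<and> (\<forall>v\<in>V. (\<lambda>x. f x + v x) \<in> U \<inter> gs_space g M)"
      using nbhd[OF V(1)] by blast
  qed auto
  then have "continuous_map (gs_topology g M) (gs_topology g N) (\<lambda>f. f)"
    unfolding continuous_map_def topspace_gs_topology[OF M] topspace_gs_topology[OF N]
      openin_gs_topology using sub by (auto simp: Int_def conj_commute)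
  with sub show ?thesis unfolding gs_continuously_included_def by blast
qed

section \<open>Log-convex sequences\<close>

context
  fixes A :: "nat \<Rightarrow> real"
  assumes LC: "A \<in> LC"
begin

lemma LC_pos: "A p > 0" and LC_0: "A 0 = 1"
  using LC by (auto simp: LC_def)

lemma LC_quotient_mono: "p \<le> q \<Longrightarrow> A (Suc p) / A p \<le> A (Suc q) / A q"
proof (induction q rule: dec_induct)
  case (step q)
  have "(A (Suc q))\<^sup>2 \<le> A q * A (Suc (Suc q))"
    using LC by (auto simp: LC_def dest!: spec[of _ "Suc q"])
  then have "A (Suc q) / A q \<le> A (Suc (Suc q)) / A (Suc q)"
    using LC_pos[of q] LC_pos[of "Suc q"] by (simp add: field_simps power2_eq_square)
  with step show ?case by linarith
qed simp

lemma LC_mult_le: "A p * A q \<le> A (p + q)"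
proof (induction q)
  case (Suc q)
  have "A (Suc q) / A q \<le> A (Suc (p + q)) / A (p + q)" by (rule LC_quotient_mono) simp
  then have "A (Suc q) * A (p + q) \<le> A (Suc (p + q)) * A q"
    using LC_pos[of q] LC_pos[of "p+q"] by (simp add: field_simps)
  moreover have "A (Suc q) * (A p * A q) \<le> A (Suc q) * A (p + q)"
    using Suc LC_pos[of "Suc q"] by simp
  ultimately have "(A p * A (Suc q)) * A q \<le> A (Suc (p + q)) * A q" by (simp add: ac_simps)
  then show ?case using LC_pos[of q] by simp
qed (simp add: LC_0)

text \<open>
  Divided by \<open>m\<^bsup>k+1\<^esup>\<close>, where \<open>m = A\<^bsub>k+1\<^esub> / A\<^sub>k\<close>, this says that the geometric sequence with ratio
  \<open>m\<close> through the point \<open>A\<^bsub>k+1\<^esub>\<close> stays below \<open>A\<close>: the quotients of \<open>A\<close> are at most \<open>m\<close> to the left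
  of that point and at least \<open>m\<close> to its right.
\<close>

lemma LC_tangent: "A (Suc k) * (A (Suc k) / A k) ^ j \<le> A j * (A (Suc k) / A k) ^ Suc k"
proof (cases "j \<le> k")
  case True
  have m: "A (Suc k) / A k > 0" using LC_pos by simp
  have "A (j + i) \<le> A j * (A (Suc k) / A k) ^ i" if "j + i \<le> Suc k" for i
    using that
  proof (induction i)
    case (Suc i)
    have "A (Suc (j + i)) = A (j + i) * (A (Suc (j + i)) / A (j + i))"
      using LC_pos[of "j+i"] by simp
    also have "\<dots> \<le> (A j * (A (Suc k) / A k) ^ i) * (A (Suc k) / A k)"
      using Suc LC_pos by (intro mult_mono LC_quotient_mono)
         (auto intro!: mult_nonneg_nonneg divide_nonneg_nonneg zero_le_power less_imp_le)
    finally show ?case by (simp add: ac_simps)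
  qed simp
  from this[of "Suc k - j"] have "A (Suc k) \<le> A j * (A (Suc k) / A k) ^ (Suc k - j)"
    using True by simp
  then have "A (Suc k) * (A (Suc k) / A k) ^ j
      \<le> A j * (A (Suc k) / A k) ^ (Suc k - j) * (A (Suc k) / A k) ^ j"
    using m by (intro mult_right_mono) auto
  also have "\<dots> = A j * (A (Suc k) / A k) ^ Suc k"
    using True by (simp add: power_add[symmetric] mult.assoc)
  finally show ?thesis .
next
  case False
  have m: "A (Suc k) / A k > 0" using LC_pos by simp
  have "A (Suc k) * (A (Suc k) / A k) ^ i \<le> A (Suc k + i)" for i
  proof (induction i)
    case (Suc i)
    have "(A (Suc k) * (A (Suc k) / A k) ^ i) * (A (Suc k) / A k)
        \<le> A (Suc k + i) * (A (Suc (Suc k + i)) / A (Suc k + i))"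
      using Suc m LC_pos by (intro mult_mono LC_quotient_mono) (auto intro: less_imp_le)
    also have "\<dots> = A (Suc (Suc k + i))" using LC_pos[of "Suc k + i"] by simp
    finally show ?case by (simp add: ac_simps)
  qed simp
  from this[of "j - Suc k"]
  have "A (Suc k) * (A (Suc k) / A k) ^ (j - Suc k) \<le> A j" using False by simp
  then have "A (Suc k) * (A (Suc k) / A k) ^ (j - Suc k) * (A (Suc k) / A k) ^ Suc k
      \<le> A j * (A (Suc k) / A k) ^ Suc k"
    using m by (intro mult_right_mono zero_le_power) (auto simp: less_imp_le)
  moreover have "(A (Suc k) / A k) ^ (j - Suc k) * (A (Suc k) / A k) ^ Suc k = (A (Suc k) / A k) ^ j"
    unfolding power_add[symmetric] using False by simp
  ultimately show ?thesis by (simp only: mult.assoc)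
qed

text \<open>
  The quotients \<open>A\<^sub>k / A\<^bsub>k+1\<^esub>\<close> decrease and have a finite sum \<open>S\<close>, so \<open>(p + 1) A\<^sub>p / A\<^bsub>p+1\<^esub> \<le> S\<close>; the
  claim follows by multiplying these inequalities.
\<close>

lemma fact_le_non_quasianalytic:
  assumes "non_quasianalytic A"
  shows "\<exists>S>0. \<forall>p. fact p \<le> S ^ p * A p"
proof -
  define S where "S = (\<Sum>k. A k / A (Suc k))"
  have sm: "summable (\<lambda>k. A k / A (Suc k))" using assms by (simp add: non_quasianalytic_def)
  have pos: "A k / A (Suc k) > 0" for k using LC_pos by simp
  have S: "S > 0" unfolding S_def using sm pos by (intro suminf_pos) auto
  have le_S: "real (Suc p) * (A p / A (Suc p)) \<le> S" for p
  proof -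
    have "A p / A (Suc p) \<le> A k / A (Suc k)" if "k \<le> p" for k
      using LC_quotient_mono[OF that] LC_pos[of k] LC_pos[of p] LC_pos[of "Suc k"] LC_pos[of "Suc p"]
      by (simp add: field_simps)
    then have "(\<Sum>k<Suc p. A p / A (Suc p)) \<le> (\<Sum>k<Suc p. A k / A (Suc k))"
      by (intro sum_mono) auto
    also have "\<dots> \<le> S"
      unfolding S_def using sm pos by (intro sum_le_suminf) (auto intro: less_imp_le)
    finally show ?thesis by simp
  qed
  have step: "real (Suc p) * A p \<le> S * A (Suc p)" for p
    using LC_pos[of "Suc p"] pos_divide_le_eq[of "A (Suc p)" "real (Suc p) * A p" S] le_S[of p]
    by simp
  have "fact p \<le> S ^ p * A p" for p
  proof (induction p)
    case (Suc p)
    have "(fact (Suc p) :: real) = real (Suc p) * fact p" by simp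
    also have "\<dots> \<le> real (Suc p) * (S ^ p * A p)" using Suc by (intro mult_left_mono) auto
    also have "\<dots> \<le> S ^ p * (S * A (Suc p))"
      using mult_left_mono[OF step[of p], of "S ^ p"] S by (simp add: ac_simps)
    finally show ?case by (simp add: ac_simps)
  qed (simp add: LC_0)
  with S show ?thesis by blast
qed

end

section \<open>The Gaussian\<close>

definition gauss :: "complex \<Rightarrow> complex" where
  "gauss z = exp (- z\<^sup>2)"

lemma gauss_holomorphic: "gauss holomorphic_on S"
  unfolding gauss_def by (intro holomorphic_intros)

text \<open>
  On the circle of radius \<open>1\<close> around \<open>x\<close> one has \<open>(Im z)\<^sup>2 \<le> 1\<close> and
  \<open>(Re z)\<^sup>2 \<ge> |Re z| - 1/4 \<ge> |x| - 5/4\<close>, so the Gaussian is at most \<open>exp (9/4 - |x|)\<close> there. Cauchy's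
  inequality turns this into a bound for the derivatives, and \<open>exp (-|x|)\<close> absorbs \<open>|x|\<^sup>a / a!\<close>.
\<close>

lemma monomial_gauss_deriv_bound:
  "\<bar>x\<bar> ^ a * norm ((deriv ^^ b) gauss (of_real x)) \<le> exp (9 / 4) * (fact a * fact b)"
proof -
  have nrm: "norm (gauss z) \<le> exp (9 / 4 - \<bar>x\<bar>)" if z: "norm (of_real x - z) = 1" for z
  proof -
    have 1: "\<bar>x - Re z\<bar> \<le> 1" using abs_Re_le_cmod[of "of_real x - z"] z by simp
    have 2: "\<bar>Im z\<bar> \<le> 1" using abs_Im_le_cmod[of "of_real x - z"] z by simp
    have "(Im z)\<^sup>2 \<le> 1" using 2 by (simp add: abs_square_le_1)
    moreover have "\<bar>Re z\<bar> \<le> (Re z)\<^sup>2 + 1 / 4"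
      using zero_le_power2[of "\<bar>Re z\<bar> - 1 / 2"] by (simp add: power2_diff power_divide)
    ultimately have "(Im z)\<^sup>2 - (Re z)\<^sup>2 \<le> 9 / 4 - \<bar>x\<bar>" using 1 by linarith
    then show ?thesis by (simp add: gauss_def power2_eq_square)
  qed
  have "norm ((deriv ^^ b) gauss (of_real x)) \<le> fact b * exp (9 / 4 - \<bar>x\<bar>) / 1 ^ b"
    using nrm
    by (intro Cauchy_inequality holomorphic_on_imp_continuous_on gauss_holomorphic) auto
  moreover have "\<bar>x\<bar> ^ a \<le> fact a * exp \<bar>x\<bar>"
  proof -
    have "\<bar>x\<bar> ^ a / fact a = (\<Sum>n\<in>{a}. \<bar>x\<bar> ^ n /\<^sub>R fact n)" by (simp add: field_simps)
    also have "\<dots> \<le> exp \<bar>x\<bar>"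
      unfolding exp_def by (intro sum_le_suminf summable_exp_generic) auto
    finally show ?thesis by (simp add: field_simps)
  qed
  ultimately have "\<bar>x\<bar> ^ a * norm ((deriv ^^ b) gauss (of_real x))
      \<le> (fact a * exp \<bar>x\<bar>) * (fact b * exp (9 / 4 - \<bar>x\<bar>))"
    by (intro mult_mono) auto
  then show ?thesis by (simp add: exp_diff ac_simps)
qed

text \<open>
  This is the three-term recursion of the Hermite polynomials, obtained by differentiating
  \<open>g' = -2 z g\<close> repeatedly.
\<close>

lemma gauss_deriv_recursion:
  "(deriv ^^ Suc (Suc n)) gauss z =
     - 2 * z * (deriv ^^ Suc n) gauss z - 2 * of_nat (Suc n) * (deriv ^^ n) gauss z"
proof (induction n arbitrary: z)
  case 0
  have d: "deriv gauss = (\<lambda>z. - 2 * z * gauss z)"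
    unfolding gauss_def by (intro ext DERIV_imp_deriv) (auto intro!: derivative_eq_intros)
  have "(gauss has_field_derivative - 2 * z * gauss z) (at z)"
    unfolding gauss_def by (auto intro!: derivative_eq_intros)
  then show ?case unfolding d funpow.simps o_def
    by (intro DERIV_imp_deriv) (auto intro!: derivative_eq_intros simp: d algebra_simps)
next
  case (Suc n)
  have d: "((deriv ^^ m) gauss has_field_derivative (deriv ^^ Suc m) gauss z) (at z)" for m z
    using holomorphic_derivI[OF holomorphic_higher_deriv[OF gauss_holomorphic open_UNIV], of z m]
    by simp
  have e: "(deriv ^^ Suc (Suc n)) gauss =
     (\<lambda>z. - 2 * z * (deriv ^^ Suc n) gauss z - 2 * of_nat (Suc n) * (deriv ^^ n) gauss z)"
    using Suc by blast
  have "((\<lambda>z. - 2 * z * (deriv ^^ Suc n) gauss z - 2 * of_nat (Suc n) * (deriv ^^ n) gauss z)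
      has_field_derivative
        - 2 * z * (deriv ^^ Suc (Suc n)) gauss z - 2 * of_nat (Suc (Suc n)) * (deriv ^^ Suc n) gauss z)
      (at z)"
    by (rule derivative_eq_intros d refl)+ (simp add: algebra_simps)
  then show ?case
    unfolding e[symmetric] by (simp only: funpow.simps(2)[of "Suc (Suc n)"] o_apply DERIV_imp_deriv)
qed

text \<open>
  At \<open>0\<close> the recursion multiplies by \<open>-2 (n + 1) = i\<^sup>2 2 (n + 1)\<close> from one derivative to the next
  but one.
\<close>

lemma gauss_deriv_zero: "\<exists>t\<ge>0. (deriv ^^ n) gauss 0 = \<i> ^ n * of_real t"
proof (induction n rule: induct_nat_012)
  case 0 then show ?case by (auto simp: gauss_def intro: exI[of _ 1])
next
  case 1
  have "(gauss has_field_derivative 0) (at 0)"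
    unfolding gauss_def by (auto intro!: derivative_eq_intros)
  then show ?case by (auto simp: DERIV_imp_deriv intro: exI[of _ 0])
next
  case (ge2 n)
  then obtain t where t: "t \<ge> 0" "(deriv ^^ n) gauss 0 = \<i> ^ n * of_real t" by blast
  have "(deriv ^^ Suc (Suc n)) gauss 0 = \<i> ^ Suc (Suc n) * of_real (2 * real (Suc n) * t)"
    unfolding gauss_deriv_recursion t(2) by (simp add: algebra_simps)
  moreover have "2 * real (Suc n) * t \<ge> 0" using t by simp
  ultimately show ?case by blast
qed

section \<open>A function with large derivatives at the origin\<close>

lemma has_vector_derivative_suminf:
  fixes f :: "nat \<Rightarrow> real \<Rightarrow> 'b::banach"
  assumes d: "\<And>n x. (f n has_vector_derivative f' n x) (at x)"
    and B: "\<And>n x. norm (f' n x) \<le> B n" "summable B"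
    and s: "\<And>x. summable (\<lambda>n. f n x)"
  shows "((\<lambda>x. \<Sum>n. f n x) has_vector_derivative (\<Sum>n. f' n x)) (at x)"
proof -
  have u: "uniform_limit UNIV (\<lambda>n x. \<Sum>i<n. f' i x) (\<lambda>x. \<Sum>i. f' i x) sequentially"
    using B by (intro Weierstrass_m_test) auto
  have "\<exists>g. \<forall>x\<in>UNIV. (\<lambda>n. f n x) sums g x \<and>
      (g has_derivative (\<lambda>h. h *\<^sub>R (\<Sum>n. f' n x))) (at x within UNIV)"
  proof (rule has_derivative_series)
    show "\<forall>\<^sub>F n in sequentially. \<forall>x\<in>UNIV. \<forall>h.
        norm ((\<Sum>i<n. h *\<^sub>R f' i x) - h *\<^sub>R (\<Sum>i. f' i x)) \<le> e * norm h" if "e > 0" for e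
      using uniform_limitD[OF u that]
    proof eventually_elim
      case (elim n)
      show ?case
      proof (intro ballI allI)
        fix x h
        have "norm ((\<Sum>i<n. h *\<^sub>R f' i x) - h *\<^sub>R (\<Sum>i. f' i x))
            = \<bar>h\<bar> * norm ((\<Sum>i<n. f' i x) - (\<Sum>i. f' i x))"
          by (simp add: scaleR_sum_right[symmetric] scaleR_diff_right[symmetric])
        also have "\<dots> \<le> \<bar>h\<bar> * e" using elim by (intro mult_left_mono) (auto simp: dist_norm less_imp_le)
        finally show "norm ((\<Sum>i<n. h *\<^sub>R f' i x) - h *\<^sub>R (\<Sum>i. f' i x)) \<le> e * norm h"
          by (simp add: mult.commute)
      qed
    qed
  qed (use d s in \<open>auto simp: has_vector_derivative_def intro: summable_sums\<close>)
  then obtain g where g: "\<And>x. (\<lambda>n. f n x) sums g x"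
      "\<And>x. (g has_derivative (\<lambda>h. h *\<^sub>R (\<Sum>n. f' n x))) (at x)" by auto
  have "g = (\<lambda>x. \<Sum>n. f n x)" using g(1) by (auto simp: sums_iff)
  then show ?thesis using g(2) by (simp add: has_vector_derivative_def)
qed

definition wave :: "real \<Rightarrow> complex \<Rightarrow> complex" where
  "wave \<tau> z = exp (\<i> * of_real \<tau> * z) * gauss z"

lemma wave_holomorphic: "wave \<tau> holomorphic_on S"
  unfolding wave_def by (intro holomorphic_intros gauss_holomorphic)

lemma wave_deriv:
  "(deriv ^^ n) (wave \<tau>) z = (\<Sum>j=0..n. of_nat (n choose j) *
      ((\<i> * of_real \<tau>) ^ j * exp (\<i> * of_real \<tau> * z)) * (deriv ^^ (n - j)) gauss z)"
proof -
  have e: "(deriv ^^ j) (\<lambda>z. exp (c * z)) = (\<lambda>z. c ^ j * exp (c * z))" for c :: complex and j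
  proof (induction j)
    case (Suc j)
    show ?case unfolding funpow.simps o_def Suc
      by (intro ext DERIV_imp_deriv) (auto intro!: derivative_eq_intros)
  qed simp
  show ?thesis
    unfolding wave_def
    by (subst higher_deriv_mult[OF _ gauss_holomorphic open_UNIV]) (auto intro!: holomorphic_intros simp: e)
qed

text \<open>
  Cauchy's inequality for \<open>wave \<tau>\<close> itself, on circles of a fixed radius \<open>r\<close>, would cost a factor
  \<open>exp (r \<tau>)\<close>, which the coefficients of the series cannot absorb. The product rule keeps the powers \<open>\<tau>\<^sup>j\<close> apart.
\<close>

lemma wave_deriv_bound:
  assumes "\<tau> \<ge> 0"
  shows "\<bar>x\<bar> ^ a * norm ((deriv ^^ n) (wave \<tau>) (of_real x))
    \<le> exp (9 / 4) * fact a * (\<Sum>j=0..n. real (n choose j) * \<tau> ^ j * fact (n - j))"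
proof -
  have "\<bar>x\<bar> ^ a * norm ((deriv ^^ n) (wave \<tau>) (of_real x))
      \<le> \<bar>x\<bar> ^ a * (\<Sum>j=0..n. real (n choose j) * \<tau> ^ j * norm ((deriv ^^ (n - j)) gauss (of_real x)))"
    unfolding wave_deriv using assms
    by (intro mult_left_mono order_trans[OF norm_sum] sum_mono)
       (auto simp: norm_mult norm_power)
  also have "\<dots> = (\<Sum>j=0..n. real (n choose j) * \<tau> ^ j *
      (\<bar>x\<bar> ^ a * norm ((deriv ^^ (n - j)) gauss (of_real x))))"
    by (simp add: sum_distrib_left ac_simps)
  also have "\<dots> \<le> (\<Sum>j=0..n. real (n choose j) * \<tau> ^ j * (exp (9 / 4) * (fact a * fact (n - j))))"
    using assms by (intro sum_mono mult_left_mono monomial_gauss_deriv_bound) auto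
  also have "\<dots> = exp (9 / 4) * fact a * (\<Sum>j=0..n. real (n choose j) * \<tau> ^ j * fact (n - j))"
    by (simp add: sum_distrib_left ac_simps)
  finally show ?thesis .
qed

text \<open>
  All summands of the product rule carry the same power of \<open>i\<close> and a nonnegative factor, so the
  summand \<open>j = n\<close> alone bounds the result from below.
\<close>

lemma wave_deriv_zero:
  assumes "\<tau> \<ge> 0"
  shows "\<exists>r\<ge>\<tau> ^ n. (deriv ^^ n) (wave \<tau>) 0 = \<i> ^ n * of_real r"
proof -
  obtain t where t: "\<And>n. t n \<ge> 0" "\<And>n. (deriv ^^ n) gauss 0 = \<i> ^ n * of_real (t n)"
    using gauss_deriv_zero by metis
  have t0: "t 0 = 1" using t(2)[of 0] by (simp add: gauss_def)
  define r where "r = (\<Sum>j=0..n. real (n choose j) * \<tau> ^ j * t (n - j))"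
  have "(deriv ^^ n) (wave \<tau>) 0 = (\<Sum>j=0..n. \<i> ^ n * of_real (real (n choose j) * \<tau> ^ j * t (n - j)))"
    unfolding wave_deriv t(2)
    by (intro sum.cong) (auto simp: power_mult_distrib algebra_simps simp flip: power_add)
  also have "\<dots> = \<i> ^ n * of_real r" unfolding r_def by (simp add: sum_distrib_left)
  finally have "(deriv ^^ n) (wave \<tau>) 0 = \<i> ^ n * of_real r" .
  moreover have "\<tau> ^ n \<le> r"
    unfolding r_def using assms t t0
    by (intro order_trans[OF _ member_le_sum[of n]]) auto
  ultimately show ?thesis by blast
qed

text \<open>
  The functions \<open>F n\<close> are the derivatives of \<open>F 0 x = \<Sum>\<^sub>k c\<^sub>k exp(i \<tau>\<^sub>k x) exp(-x\<^sup>2)\<close>. The numbers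
  \<open>\<tau>\<^sub>k\<close> and \<open>c\<^sub>k\<close> are chosen such that \<open>c\<^sub>k \<tau>\<^sub>k\<^bsup>k+1\<^esup> = A\<^bsub>k+1\<^esub>\<close>; the factor \<open>2\<close> in \<open>\<tau>\<^sub>k\<close> makes
  the series for every derivative dominated by a geometric one.
\<close>

lemma exists_large_derivatives_at_zero:
  assumes A: "A \<in> LC" and S: "S > 0" "\<And>p. fact p \<le> S ^ p * A p"
  shows "\<exists>F :: nat \<Rightarrow> real \<Rightarrow> complex.
      (\<forall>n x. (F n has_vector_derivative F (Suc n) x) (at x)) \<and>
      (\<forall>a b x. \<bar>x\<bar> ^ a * norm (F b x) \<le> exp (9 / 4) * ((2 + S) ^ (a + b) * (A a * A b))) \<and>
      (\<forall>p\<ge>1. A p \<le> norm (F p 0))"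
proof -
  note pos = LC_pos[OF A]
  define \<tau> where "\<tau> k = 2 * (A (Suc k) / A k)" for k
  define c where "c k = A (Suc k) / \<tau> k ^ Suc k" for k
  have \<tau>: "\<tau> k > 0" for k using pos by (simp add: \<tau>_def)
  then have c: "c k > 0" for k using pos unfolding c_def by (intro divide_pos_pos zero_less_power)
  \<comment> \<open>The supporting line of slope \<open>log (\<tau>\<^sub>k / 2)\<close>; the powers of two left over give the decay in \<open>k\<close>.\<close>
  have ctau: "c k * \<tau> k ^ j \<le> 2 ^ j * A j * (1 / 2) ^ Suc k" for k j
  proof -
    have m: "A (Suc k) / A k > 0" using pos by simp
    have "c k * \<tau> k ^ j
        = 2 ^ j * (1 / 2) ^ Suc k * (A (Suc k) * (A (Suc k) / A k) ^ j / (A (Suc k) / A k) ^ Suc k)"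
      unfolding c_def \<tau>_def power_mult_distrib using pos[of k] pos[of "Suc k"]
      by (simp add: power_divide field_simps)
    also have "\<dots> \<le> 2 ^ j * (1 / 2) ^ Suc k * A j"
      using LC_tangent[OF A, of k j] m
      by (intro mult_left_mono) (auto simp: pos_divide_le_eq simp del: power_Suc)
    finally show ?thesis by (simp add: ac_simps)
  qed
  \<comment> \<open>Up to the constant of the Gaussian and \<open>a!\<close>, \<open>Q n\<close> bounds the \<open>n\<close>-th derivative summed over \<open>k\<close>.\<close>
  define Q where "Q n = (\<Sum>j=0..n. real (n choose j) * (2 ^ j * A j) * fact (n - j))" for n
  have Q0: "Q n \<ge> 0" for n unfolding Q_def using pos by (intro sum_nonneg) (auto intro: less_imp_le)
  have Q: "Q n \<le> (2 + S) ^ n * A n" for n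
  proof -
    have "Q n \<le> (\<Sum>j=0..n. real (n choose j) * 2 ^ j * S ^ (n - j) * A n)"
      unfolding Q_def
    proof (intro sum_mono)
      fix j assume j: "j \<in> {0..n}"
      have "real (n choose j) * (2 ^ j * A j) * fact (n - j)
          \<le> real (n choose j) * (2 ^ j * A j) * (S ^ (n - j) * A (n - j))"
        using pos by (intro mult_left_mono S mult_nonneg_nonneg) (auto intro: less_imp_le)
      also have "\<dots> = real (n choose j) * 2 ^ j * S ^ (n - j) * (A j * A (n - j))" by simp
      also have "\<dots> \<le> real (n choose j) * 2 ^ j * S ^ (n - j) * A n"
        using LC_mult_le[OF A, of j "n - j"] j S(1) by (intro mult_left_mono) auto
      finally show "real (n choose j) * (2 ^ j * A j) * fact (n - j) \<le> \<dots>" .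
    qed
    also have "\<dots> = (2 + S) ^ n * A n"
      by (simp add: binomial_ring sum_distrib_right atMost_atLeast0)
    finally show ?thesis .
  qed
  define f where "f n k x = of_real (c k) * (deriv ^^ n) (wave (\<tau> k)) (of_real x)" for n k and x :: real
  have bound: "\<bar>x\<bar> ^ a * norm (f n k x) \<le> exp (9 / 4) * fact a * Q n * (1 / 2) ^ Suc k" for a n k x
  proof -
    have "\<bar>x\<bar> ^ a * norm (f n k x) = c k * (\<bar>x\<bar> ^ a * norm ((deriv ^^ n) (wave (\<tau> k)) (of_real x)))"
      unfolding f_def using c[of k] by (simp add: norm_mult)
    also have "\<dots> \<le> c k * (exp (9 / 4) * fact a *
        (\<Sum>j=0..n. real (n choose j) * \<tau> k ^ j * fact (n - j)))"
      using c[of k] \<tau>[of k] by (intro mult_left_mono wave_deriv_bound) auto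
    also have "\<dots> = exp (9 / 4) * fact a *
        (\<Sum>j=0..n. real (n choose j) * (c k * \<tau> k ^ j) * fact (n - j))"
      by (simp add: sum_distrib_left ac_simps)
    also have "\<dots> \<le> exp (9 / 4) * fact a *
        (\<Sum>j=0..n. real (n choose j) * (2 ^ j * A j * (1 / 2) ^ Suc k) * fact (n - j))"
      by (intro mult_left_mono sum_mono mult_right_mono ctau) auto
    also have "\<dots> = exp (9 / 4) * fact a * Q n * (1 / 2) ^ Suc k"
      unfolding Q_def by (simp add: sum_distrib_left sum_distrib_right ac_simps)
    finally show ?thesis .
  qed
  have geo: "(\<lambda>k. exp (9 / 4) * fact a * Q n * (1 / 2) ^ Suc k) sums (exp (9 / 4) * fact a * Q n)" for a n
    using sums_mult[OF power_half_series, of "exp (9 / 4) * fact a * Q n"] by simp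
  have fbound: "norm (f n k x) \<le> exp (9 / 4) * fact 0 * Q n * (1 / 2) ^ Suc k" for n k x
    using bound[of x 0 n k] by simp
  have sf: "summable (\<lambda>k. norm (f n k x))" for n x
    using geo[of 0 n] fbound[of n] by (intro summable_comparison_test'[OF sums_summable]) auto
  define F where "F n x = (\<Sum>k. f n k x)" for n x
  show ?thesis
  proof (intro exI[of _ F] conjI allI impI)
    fix n x
    have "(f n k has_vector_derivative f (Suc n) k x) (at x)" for k x
    proof -
      have "((deriv ^^ n) (wave (\<tau> k)) has_field_derivative (deriv ^^ Suc n) (wave (\<tau> k)) (of_real x))
          (at (of_real x))"
        using holomorphic_derivI[OF holomorphic_higher_deriv[OF wave_holomorphic open_UNIV],
            of "of_real x" n "\<tau> k"] by simp
      then have "((\<lambda>x. (deriv ^^ n) (wave (\<tau> k)) (of_real x)) has_vector_derivative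
          (deriv ^^ Suc n) (wave (\<tau> k)) (of_real x)) (at x)"
        by (rule has_vector_derivative_real_field)
      then show ?thesis unfolding f_def by (rule has_vector_derivative_mult_right)
    qed
    then show "(F n has_vector_derivative F (Suc n) x) (at x)"
      unfolding F_def
      by (rule has_vector_derivative_suminf[OF _ fbound sums_summable[OF geo]
            summable_norm_cancel[OF sf]])
  next
    fix a b :: nat and x :: real
    have "\<bar>x\<bar> ^ a * norm (F b x) \<le> \<bar>x\<bar> ^ a * (\<Sum>k. norm (f b k x))"
      unfolding F_def by (intro mult_left_mono summable_norm sf) auto
    also have "\<dots> = (\<Sum>k. \<bar>x\<bar> ^ a * norm (f b k x))" by (rule suminf_mult[OF sf, symmetric])
    also have "\<dots> \<le> exp (9 / 4) * fact a * Q b"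
      by (rule sums_le[OF bound summable_sums geo]) (intro summable_mult sf)
    also have "\<dots> \<le> exp (9 / 4) * ((2 + S) ^ a * A a) * ((2 + S) ^ b * A b)"
    proof (intro mult_mono mult_left_mono Q)
      have "fact a \<le> S ^ a * A a" by (rule S)
      also have "\<dots> \<le> (2 + S) ^ a * A a" using S(1) pos[of a] by (intro mult_right_mono power_mono) auto
      finally show "fact a \<le> (2 + S) ^ a * A a" .
    qed (use Q0 pos S(1) in \<open>auto intro!: mult_nonneg_nonneg simp: less_imp_le\<close>)
    finally show "\<bar>x\<bar> ^ a * norm (F b x) \<le> exp (9 / 4) * ((2 + S) ^ (a + b) * (A a * A b))"
      by (simp add: power_add ac_simps)
  next
    fix p :: nat assume p: "p \<ge> 1"
    obtain r where r: "\<And>k. r k \<ge> \<tau> k ^ p"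
        "\<And>k. (deriv ^^ p) (wave (\<tau> k)) 0 = \<i> ^ p * of_real (r k)"
      using wave_deriv_zero[of "\<tau> _" p] \<tau> less_imp_le by metis
    have r0: "r k \<ge> 0" for k using r(1)[of k] \<tau>[of k] by (meson less_imp_le order_trans zero_le_power)
    have f0: "f p k 0 = \<i> ^ p * of_real (c k * r k)" for k unfolding f_def by (simp add: r(2))
    have nf: "norm (f p k 0) = c k * r k" for k
      unfolding f0 using c[of k] r0[of k] by (simp add: norm_mult norm_power)
    have s: "summable (\<lambda>k. c k * r k)" using sf[of p 0] unfolding nf .
    have "F p 0 = \<i> ^ p * of_real (\<Sum>k. c k * r k)"
      unfolding F_def f0 using s by (simp add: suminf_mult suminf_of_real summable_of_real del: of_real_mult)
    then have "norm (F p 0) = (\<Sum>k. c k * r k)"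
      using c r0 s by (simp add: norm_mult norm_power suminf_nonneg less_imp_le)
    moreover have "A p = c (p - 1) * \<tau> (p - 1) ^ p"
      using p \<tau>[of "p - 1"] by (simp add: c_def)
    moreover have "\<dots> \<le> c (p - 1) * r (p - 1)" using r(1) c by (intro mult_left_mono) (auto simp: less_imp_le)
    moreover have "\<dots> \<le> (\<Sum>k. c k * r k)"
      using sum_le_suminf[OF s, of "{p - 1}"] c r0 by (simp add: less_imp_le)
    ultimately show "A p \<le> norm (F p 0)" by linarith
  qed
qed

section \<open>The one-dimensional case\<close>

lemma card_1_index:
  assumes "CARD('d::finite) = 1"
  obtains i0 where "(UNIV :: 'd set) = {i0}"
  using assms by (auto simp: card_1_singleton_iff)

text \<open>
  When the index type has a single element, a sequence of functions of one real variable, each the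
  derivative of its predecessor, yields all partial derivatives of the function of the coordinate.
\<close>

context
  fixes F :: "nat \<Rightarrow> real \<Rightarrow> complex" and i0 :: "'d::finite"
  assumes F: "\<And>n x. (F n has_vector_derivative F (Suc n) x) (at x)"
    and only: "(UNIV :: 'd set) = {i0}"
begin

lemma line_has_vector_derivative:
  "((\<lambda>t. F n ((x + t *\<^sub>R axis i 1) $ i0)) has_vector_derivative F (Suc n) (x $ i0)) (at 0)"
proof -
  have "i = i0" using only by blast
  then have e: "(x + t *\<^sub>R axis i 1) $ i0 = x $ i0 + t" for t :: real by (simp add: axis_def)
  have "((\<lambda>t. x $ i0 + t) has_vector_derivative 1) (at 0)"
    by (auto intro!: derivative_eq_intros)
  from vector_diff_chain_at[OF this, of "F n" "F (Suc n) (x $ i0)"] F show ?thesis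
    unfolding e by (simp add: o_def)
qed

lemma fold_partial_deriv_line:
  "fold partial_deriv is (\<lambda>x. F n (x $ i0)) = (\<lambda>x. F (n + length is) (x $ i0))"
proof (induction "is" arbitrary: n)
  case (Cons i "is")
  have "partial_deriv i (\<lambda>x. F n (x $ i0)) = (\<lambda>x. F (Suc n) (x $ i0))"
    unfolding partial_deriv_def using line_has_vector_derivative by (intro ext vector_derivative_at)
  with Cons show ?case by simp
qed simp

lemma smooth_line: "smooth (\<lambda>x. F n (x $ i0))"
  unfolding smooth_def fold_partial_deriv_line
proof (intro allI conjI)
  have "continuous_on UNIV (F m)" for m
    by (intro continuous_at_imp_continuous_on ballI has_vector_derivative_continuous[OF F])
  then show "continuous_on UNIV (\<lambda>x. F (n + length is) (x $ i0))" for "is" :: "'d list"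
    by (rule continuous_on_compose2) (auto intro: continuous_intros)
  show "(\<lambda>t. F (n + length is) ((x + t *\<^sub>R axis i 1) $ i0)) differentiable at 0"
    for "is" :: "'d list" and i x
    using line_has_vector_derivative differentiableI_vector by blast
qed

lemma multi_deriv_line: "multi_deriv \<beta> (\<lambda>x. F n (x $ i0)) = (\<lambda>x. F (n + \<beta> $ i0) (x $ i0))"
proof -
  define l where "l = (SOME is. distinct is \<and> set is = (UNIV :: 'd set))"
  have "distinct l \<and> set l = {i0}"
    unfolding l_def only[symmetric] using someI_ex[OF finite_distinct_list[OF finite, of "UNIV :: 'd set"]]
    by (simp only: conj_commute)
  then have "l = [i0]"
    by (metis distinct_singleton distinct_length_2_or_more empty_iff empty_set
        list.exhaust list.set_intros(1) list.set_intros(2) singleton_iff)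
  then show ?thesis
    unfolding multi_deriv_def l_def[symmetric]
    by (simp add: fold_funpow_eq_fold_concat fold_partial_deriv_line flip: fold_replicate)
qed

end

text \<open>
  The bound is the one for separated growth; it suffices for joint growth because
  \<open>A\<^sub>a A\<^sub>b \<le> A\<^bsub>a+b\<^esub>\<close> for log-convex \<open>A\<close>.
\<close>

lemma gs_step_lineI:
  fixes A :: "nat ^ 'd::finite \<Rightarrow> real"
  assumes F: "\<And>n x. (F n has_vector_derivative F (Suc n) x) (at x)"
    and only: "(UNIV :: 'd set) = {i0}"
    and LC: "(\<lambda>p. A (vec p)) \<in> LC"
    and h: "h > 0" and C: "C \<ge> 0"
    and bound: "\<And>a b x. \<bar>x\<bar> ^ a * norm (F b x) \<le> C * (h ^ (a + b) * (A (vec a) * A (vec b)))"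
  shows "(\<lambda>x. F 0 (x $ i0)) \<in> gs_step g A h"
proof -
  have vec_index: "vec (\<alpha> $ i0) = \<alpha>" for \<alpha> :: "nat ^ 'd"
    using only by (auto simp: vec_eq_iff)
  have A: "A \<alpha> > 0" for \<alpha> using LC_pos[OF LC, of "\<alpha> $ i0"] vec_index[of \<alpha>] by simp
  have "norm (monomial \<alpha> x *\<^sub>R multi_deriv \<beta> (\<lambda>x. F 0 (x $ i0)) x)
      \<le> C * (h ^ mlength (\<alpha> + \<beta>) * growth_weight g A \<alpha> \<beta>)" for \<alpha> \<beta> x
  proof -
    have "norm (monomial \<alpha> x *\<^sub>R multi_deriv \<beta> (\<lambda>x. F 0 (x $ i0)) x)
        = \<bar>x $ i0\<bar> ^ (\<alpha> $ i0) * norm (F (\<beta> $ i0) (x $ i0))"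
      unfolding multi_deriv_line[of F, OF F only] by (simp add: monomial_def only power_abs)
    also have "\<dots> \<le> C * (h ^ mlength (\<alpha> + \<beta>) * (A \<alpha> * A \<beta>))"
      using bound[of "x $ i0" "\<alpha> $ i0" "\<beta> $ i0"] by (simp add: mlength_def only add: vec_index)
    also have "\<dots> \<le> C * (h ^ mlength (\<alpha> + \<beta>) * growth_weight g A \<alpha> \<beta>)"
    proof -
      have "vec (\<alpha> $ i0 + \<beta> $ i0) = \<alpha> + \<beta>" using only by (auto simp: vec_eq_iff)
      then have "A \<alpha> * A \<beta> \<le> A (\<alpha> + \<beta>)"
        using LC_mult_le[OF LC, of "\<alpha> $ i0" "\<beta> $ i0"] by (simp add: vec_index)
      then have "A \<alpha> * A \<beta> \<le> growth_weight g A \<alpha> \<beta>" by (cases g) auto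
      then show ?thesis using C h by (intro mult_left_mono) auto
    qed
    finally show ?thesis .
  qed
  then show ?thesis
    unfolding gs_step_iff[of A h, OF A h] using smooth_line[of F, OF F only] C by blast
qed

text \<open>
  For \<open>\<alpha> = 0\<close> both kinds of growth give the weight \<open>N\<^sub>k(\<beta>)\<close>, since \<open>N\<^sub>k(0) = 1\<close>.
\<close>

lemma gs_space_deriv_at_zero:
  fixes N :: "real \<Rightarrow> nat ^ 'd::finite \<Rightarrow> real"
  assumes N: "weight_matrix N" and f: "f \<in> gs_space g N"
  obtains k C h where "k > 0" "C \<ge> 0" "h > 0"
    "\<And>\<beta>. norm (multi_deriv \<beta> f 0) \<le> C * h ^ mlength \<beta> * N k \<beta>"
proof -
  obtain k h where k: "k > 0" "h > 0" "f \<in> gs_step g (N k) h"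
    using f unfolding gs_space_def by auto
  have pos: "N k \<alpha> > 0" and N0: "N k 0 = 1" for \<alpha>
    using N k(1) unfolding weight_matrix_def by blast+
  obtain C where C: "C \<ge> 0" "\<And>\<alpha> \<beta> x. norm (monomial \<alpha> x *\<^sub>R multi_deriv \<beta> f x)
      \<le> C * (h ^ mlength (\<alpha> + \<beta>) * growth_weight g (N k) \<alpha> \<beta>)"
    using k(3) unfolding gs_step_iff[of "N k" h, OF pos k(2)] by blast
  have "norm (multi_deriv \<beta> f 0) \<le> C * h ^ mlength \<beta> * N k \<beta>" for \<beta>
    using C(2)[of 0 0 \<beta>] N0 by (cases g) (simp_all add: monomial_def mult.assoc)
  with k C that show thesis by blast
qed

lemma gs_space_subset_imp_roumieu_le:
  fixes M N :: "real \<Rightarrow> nat ^ 'd::finite \<Rightarrow> real"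
  assumes M: "weight_matrix M" and N: "weight_matrix N" and card: "CARD('d) = 1"
    and LC: "standard_log_convex (\<lambda>l p. M l (vec p))"
    and nqa: "roumieu_non_quasianalytic (\<lambda>l p. M l (vec p))"
    and sub: "gs_space g M \<subseteq> gs_space g N"
  shows "roumieu_le M N"
  unfolding roumieu_le_def
proof (intro allI impI)
  fix l :: real assume l: "l > 0"
  obtain i0 :: 'd where only: "(UNIV :: 'd set) = {i0}" using card_1_index[OF card] by metis
  have vec_index: "vec (\<alpha> $ i0) = \<alpha>" for \<alpha> :: "nat ^ 'd"
    using only by (auto simp: vec_eq_iff)
  obtain l0 where l0: "l0 > 0" "non_quasianalytic (\<lambda>p. M l0 (vec p))"
    using nqa unfolding roumieu_non_quasianalytic_def by blast
  \<comment> \<open>The larger index inherits \<open>p! \<le> S\<^sup>p M\<^sub>p\<close> from the non-quasianalytic sequence \<open>M l0\<close>.\<close>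
  define m where "m = max l l0"
  have m: "m > 0" "l \<le> m" "l0 \<le> m" using l by (auto simp: m_def)
  have mono: "M k \<alpha> \<le> M k' \<alpha>" if "0 < k" "k \<le> k'" for k k' \<alpha>
    using M that unfolding weight_matrix_def by blast
  have LCm: "(\<lambda>p. M k (vec p)) \<in> LC" if "k > 0" for k
    using LC that by (simp add: standard_log_convex_def)
  obtain S where S: "S > 0" "\<And>p. fact p \<le> S ^ p * M l0 (vec p)"
    using fact_le_non_quasianalytic[OF LCm[OF l0(1)] l0(2)] by blast
  have "fact p \<le> S ^ p * M m (vec p)" for p
    using S(1) by (intro order_trans[OF S(2)] mult_left_mono mono l0 m) auto
  from exists_large_derivatives_at_zero[OF LCm[OF m(1)] S(1) this]
  obtain F :: "nat \<Rightarrow> real \<Rightarrow> complex" where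
    F: "\<And>n x. (F n has_vector_derivative F (Suc n) x) (at x)"
    and bound: "\<And>a b x. \<bar>x\<bar> ^ a * norm (F b x)
        \<le> exp (9 / 4) * ((2 + S) ^ (a + b) * (M m (vec a) * M m (vec b)))"
    and large: "\<And>p. p \<ge> 1 \<Longrightarrow> M m (vec p) \<le> norm (F p 0)"
    by metis
  have "(\<lambda>x. F 0 (x $ i0)) \<in> gs_step g (M m) (2 + S)"
    using S(1) by (intro gs_step_lineI[where C = "exp (9 / 4)"] F only LCm m bound) auto
  then have "(\<lambda>x. F 0 (x $ i0)) \<in> gs_space g M"
    unfolding gs_space_def using m(1) S(1) by (intro UN_I[of m] UN_I[of "2 + S"]) auto
  then have "(\<lambda>x. F 0 (x $ i0)) \<in> gs_space g N" using sub by blast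
  then obtain k C h where k: "k > 0" "C \<ge> 0" "h > 0" and
    up: "\<And>\<beta>. norm (multi_deriv \<beta> (\<lambda>x. F 0 (x $ i0)) 0) \<le> C * h ^ mlength \<beta> * N k \<beta>"
    using gs_space_deriv_at_zero[OF N] by metis
  have posN: "N k \<alpha> > 0" and N0: "N k 0 = 1" and M0: "M l 0 = 1" for \<alpha>
    using M N k(1) l unfolding weight_matrix_def by blast+
  \<comment> \<open>At the zero index both sequences are \<open>1\<close>; elsewhere a power of \<open>max 1 C\<close> absorbs \<open>C\<close>.\<close>
  define D where "D = max 1 C * max 1 h"
  have "M l \<alpha> \<le> D ^ mlength \<alpha> * N k \<alpha>" for \<alpha>
  proof (cases "\<alpha> $ i0 = 0")
    case True
    then have "\<alpha> = 0" using vec_index[of \<alpha>] by (metis vec_0)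
    then show ?thesis using N0 M0 by (simp add: mlength_def)
  next
    case False
    have len: "mlength \<alpha> = \<alpha> $ i0" by (simp add: mlength_def only)
    have "M l \<alpha> \<le> M m \<alpha>" using mono l m by blast
    also have "\<dots> \<le> norm (F (\<alpha> $ i0) 0)" using large[of "\<alpha> $ i0"] False by (simp add: vec_index)
    also have "\<dots> \<le> C * h ^ mlength \<alpha> * N k \<alpha>"
      using up[of \<alpha>] unfolding multi_deriv_line[of F, OF F only] by simp
    also have "C * h ^ mlength \<alpha> \<le> max 1 C ^ mlength \<alpha> * max 1 h ^ mlength \<alpha>"
    proof (intro mult_mono power_mono)
      have "C \<le> max 1 C ^ 1" by simp
      also have "\<dots> \<le> max 1 C ^ mlength \<alpha>" using False len by (intro power_increasing) auto
      finally show "C \<le> max 1 C ^ mlength \<alpha>" .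
    qed (use k in auto)
    finally show ?thesis using posN[of \<alpha>] by (simp add: D_def power_mult_distrib)
  qed
  moreover have "D \<ge> 1" unfolding D_def using mult_mono[of 1 "max 1 C" 1 "max 1 h"] by simp
  ultimately show "\<exists>k>0. seq_le (M l) (N k)" using k(1) unfolding seq_le_def by blast
qed

theorem theorem6p2:
  fixes M N :: "real \<Rightarrow> nat ^ 'd::finite \<Rightarrow> real"
  assumes "weight_matrix M" and "weight_matrix N"
  shows "(roumieu_le M N \<longrightarrow> (\<forall>g. gs_continuously_included g M N)) \<and>
         (CARD('d) = 1 \<and>
          standard_log_convex (\<lambda>l p. M l (vec p)) \<and>
          roumieu_non_quasianalytic (\<lambda>l p. M l (vec p)) \<longrightarrow>
            (\<forall>g. gs_continuously_included g M N \<longrightarrow> roumieu_le M N))"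
  using roumieu_le_imp_gs_continuously_included[OF assms]
    gs_space_subset_imp_roumieu_le[OF assms] unfolding gs_continuously_included_def by blast

end
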